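(* For any matrix $A\in\mathbb{R}_+^{n\times n}$ with $\lambda(A)>0$, the max algebraic dimension of $V^*(A)$ is equal to the (linear algebraic) dimension of $\operatorname{L}(C(A))$, which is the linear hull of $V^*(A)$.
   Context: $\mathbb{R}_+$ is the set of nonnegative reals, $n\ge 1$, $[n]=\{1,\dots,n\}$. Max algebra: $a\oplus b=\max(a,b)$ (componentwise for vectors), $(A\otimes x)_i=\max_j a_{ij}x_j$. For $A=(a_{ij})\in\mathbb{R}_+^{n\times n}$, the digraph $D_A$ has node set $[n]$ and all edges $(i,j)\in[n]\times[n]$ with weights $a_{ij}$. A cycle $(i_1,\dots,i_k,i_1)$, $k\ge1$, has geometric mean $(a_{i_1i_2}\cdots a_{i_ki_1})^{1/k}$; $\lambda(A)$ is the maximum of these over all cycles. A cycle is critical if its geometric mean equals $\lambda(A)$; $N_c(A)$ and $E_c(A)$ are the sets of nodes and edges that belong to critical cycles, and $C(A)=(N_c(A),E_c(A))$. The subeigencone is $V^*(A)=\{x\in\mathbb{R}_+^n: A\otimes x\le\lambda(A)x\}$. Define $$\operatorname{L}(C(A))=\{x\in\mathbb{R}^n: a_{ij}x_j=\lambda(A)x_i\ \ \forall (i,j)\in E_c(A)\}.$$ The linear hull of a convex cone is the least linear subspace containing it. A max cone is a subset of $\mathbb{R}_+^n$ closed under $\oplus$ and under multiplication by nonnegative scalars; $V^*(A)$ is a finitely generated max cone. A max combination of $x^1,\dots,x^m$ is $\bigoplus_i\lambda_ix^i$ with $\lambda_i\ge0$. A basis of a max cone $K$ is a subset $S\subseteq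 K$ such that every element of $K$ is a max combination of elements of $S$ and no element of $S$ is a max combination of the other elements of $S$; it is scaled if every $u\in S$ satisfies $\max_iu_i=1$. A finitely generated max cone has a unique scaled basis, and its cardinality is called the max algebraic dimension. *)

theory Defs
  imports "HOL-Analysis.Analysis"
begin

definition nonneg_matrix :: "real ^ 'n ^ 'm \<Rightarrow> bool" where
  "nonneg_matrix A \<longleftrightarrow> (\<forall>i j. 0 \<le> A $ i $ j)"

definition max_mult :: "real ^ 'n ^ 'm \<Rightarrow> real ^ 'n \<Rightarrow> real ^ 'm" where
  "max_mult A x = (\<chi> i. MAX j. A $ i $ j * x $ j)"

text \<open>
  A cycle \<open>(i\<^sub>1, \<dots>, i\<^sub>k, i\<^sub>1)\<close> of the complete digraph on the index type is represented by the
  nonempty list \<open>[i\<^sub>1, \<dots>, i\<^sub>k]\<close>; nodes may be repeated, and a loop is a list of length one.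
\<close>

definition cycle_edges :: "'n list \<Rightarrow> ('n \<times> 'n) set" where
  "cycle_edges p = {(p ! k, p ! (Suc k mod length p)) | k. k < length p}"

definition cycle_mean :: "real ^ 'n ^ 'n \<Rightarrow> 'n list \<Rightarrow> real" where
  "cycle_mean A p = root (length p) (\<Prod>k<length p. A $ (p ! k) $ (p ! (Suc k mod length p)))"

definition max_cycle_mean :: "real ^ 'n ^ 'n \<Rightarrow> real" where
  "max_cycle_mean A = (GREATEST m. \<exists>p. p \<noteq> [] \<and> m = cycle_mean A p)"

definition critical_cycle :: "real ^ 'n ^ 'n \<Rightarrow> 'n list \<Rightarrow> bool" where
  "critical_cycle A p \<longleftrightarrow> p \<noteq> [] \<and> cycle_mean A p = max_cycle_mean A"

definition critical_edges :: "real ^ 'n ^ 'n \<Rightarrow> ('n \<times> 'n) set" where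
  "critical_edges A = (\<Union>p\<in>{p. critical_cycle A p}. cycle_edges p)"

definition subeigencone :: "real ^ 'n ^ 'n \<Rightarrow> (real ^ 'n) set" where
  "subeigencone A =
    {x. (\<forall>i. 0 \<le> x $ i) \<and> (\<forall>i. max_mult A x $ i \<le> max_cycle_mean A * x $ i)}"

definition critical_space :: "real ^ 'n ^ 'n \<Rightarrow> (real ^ 'n) set" where
  "critical_space A =
    {x. \<forall>(i, j)\<in>critical_edges A. A $ i $ j * x $ j = max_cycle_mean A * x $ i}"

text \<open>
  Max combinations are taken over finitely many vectors of \<open>S\<close>, which is meant to consist of
  nonnegative vectors.  The inserted zero then only matters for the empty combination, which
  is the zero vector.
\<close>

definition max_combinations :: "(real ^ 'n) set \<Rightarrow> (real ^ 'n) set" where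
  "max_combinations S =
    {x. \<exists>T c. finite T \<and> T \<subseteq> S \<and> (\<forall>u\<in>T. 0 \<le> c u) \<and>
              x = (\<chi> i. Max (insert 0 ((\<lambda>u. c u * u $ i) ` T)))}"

definition max_basis :: "(real ^ 'n) set \<Rightarrow> (real ^ 'n) set \<Rightarrow> bool" where
  "max_basis K S \<longleftrightarrow>
    S \<subseteq> K \<and> K \<subseteq> max_combinations S \<and> (\<forall>u\<in>S. u \<notin> max_combinations (S - {u}))"

definition scaled_max_basis :: "(real ^ 'n) set \<Rightarrow> (real ^ 'n) set \<Rightarrow> bool" where
  "scaled_max_basis K S \<longleftrightarrow> max_basis K S \<and> (\<forall>u\<in>S. (MAX i. u $ i) = 1)"

text \<open>
  This is meant for finitely generated max cones \<open>K\<close>, which have exactly one scaled basis,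
  and that basis is finite.
\<close>

definition max_dim :: "(real ^ 'n) set \<Rightarrow> nat" where
  "max_dim K = card (THE S. scaled_max_basis K S)"

end

theory Submission
  imports Defs
begin

text \<open>
  Let \<open>B = A / \<lambda>(A)\<close> and let \<open>P\<close> be its Kleene star, so \<open>P i j\<close> is the largest weight of a walk
  from \<open>i\<close> to \<open>j\<close>. Then \<open>V\<^sup>*(A)\<close> consists of the nonnegative \<open>x\<close> with \<open>P i j * x j \<le> x i\<close>. It is
  generated by the columns of \<open>P\<close>; each column spans an extreme ray, and columns \<open>i\<close> and \<open>j\<close> are
  proportional iff \<open>P i j * P j i = 1\<close>, so the scaled basis has one element per class of this
  equivalence. On each class the critical equations fix \<open>x\<close> up to a factor, and they impose nothing
  else, so the dimension of \<open>L(C(A))\<close> is again the number of classes. Finally \<open>V\<^sup>*(A)\<close>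
  spans \<open>L(C(A))\<close> because it contains a point at which all noncritical inequalities are strict.
\<close>

section \<open>Maxima and max combinations\<close>

lemma MAX_cmult:
  fixes f :: "'n::finite \<Rightarrow> real"
  assumes "0 \<le> c"
  shows "(MAX i. c * f i) = c * (MAX i. f i)"
proof -
  have "mono (\<lambda>x. c * x)" using assms by (auto simp: mono_def mult_left_mono)
  then have "c * Max (range f) = Max ((\<lambda>x. c * x) ` range f)"
    by (intro mono_Max_commute) auto
  then show ?thesis by (simp add: image_image)
qed

lemma max_combinationsE:
  assumes "x \<in> max_combinations S"
  obtains T c where "finite T" "T \<subseteq> S" "\<forall>u\<in>T. 0 \<le> c u"
    "\<And>i. x $ i = Max (insert 0 ((\<lambda>u. c u * u $ i) ` T))"
  using assms unfolding max_combinations_def by auto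

lemma max_combinations_mono: "S \<subseteq> S' \<Longrightarrow> max_combinations S \<subseteq> max_combinations S'"
  unfolding max_combinations_def by blast

section \<open>Abstract Kleene stars: cone, scaled columns and scaled basis\<close>

locale kleene_star =
  fixes P :: "'n::finite \<Rightarrow> 'n \<Rightarrow> real"
  assumes nonneg: "0 \<le> P i j"
    and refl: "P i i = 1"
    and triangle: "P i j * P j k \<le> P i k"
begin

text \<open>Since \<open>P i i = 1\<close>, these are exactly the nonnegative fixed points of the
  max-linear map given by \<open>P\<close>.\<close>

definition cone :: "(real ^ 'n) set" where
  "cone = {x. (\<forall>i. 0 \<le> x $ i) \<and> (\<forall>i j. P i j * x $ j \<le> x $ i)}"

text \<open>For the star of the normalised weights, distinct nodes are related iff some critical
  closed walk passes through both. The classes are then the components of the critical graph and the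
  remaining single nodes.\<close>

definition equi :: "'n \<Rightarrow> 'n \<Rightarrow> bool" where
  "equi i j \<longleftrightarrow> P i j * P j i = 1"

text \<open>Equations for all equivalent pairs suit the dimension count;
  \<open>hull_space_eq_tight\<close> reduces them to the critical edges.\<close>

definition hull_space :: "(real ^ 'n) set" where
  "hull_space = {x. \<forall>i j. equi i j \<longrightarrow> x $ i = P i j * x $ j}"

definition column :: "'n \<Rightarrow> real ^ 'n" where
  "column j = (\<chi> i. P i j)"

definition scaled_column :: "'n \<Rightarrow> real ^ 'n" where
  "scaled_column j = (1 / (MAX i. P i j)) *\<^sub>R column j"

lemma equi_sym: "equi i j \<Longrightarrow> equi j i"
  by (simp add: equi_def mult.commute)

lemma loop_le_1: "P i j * P j i \<le> 1"
  using triangle[of i j i] refl by simp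

lemma column_nth [simp]: "column j $ i = P i j"
  by (simp add: column_def)

lemma column_in_cone: "column j \<in> cone"
  by (simp add: cone_def nonneg triangle)

lemma scale_in_cone: "x \<in> cone \<Longrightarrow> 0 \<le> c \<Longrightarrow> c *\<^sub>R x \<in> cone"
  using mult_left_mono[of "P _ _ * x $ _" "x $ _" c]
  by (auto simp: cone_def mult_left_mono mult.left_commute)

text \<open>Going round a loop of product 1 leaves no slack:
  \<open>x i = P i j * P j i * x i \<le> P i j * x j \<le> x i\<close>.\<close>

lemma cone_subset_hull_space: "cone \<subseteq> hull_space"
proof
  fix x assume x: "x \<in> cone"
  show "x \<in> hull_space" unfolding hull_space_def
  proof safe
    fix i j assume "equi i j"
    have "x $ i = P i j * (P j i * x $ i)"
      using \<open>equi i j\<close> by (simp add: equi_def flip: mult.assoc)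
    also have "\<dots> \<le> P i j * x $ j"
      using x nonneg by (intro mult_left_mono) (auto simp: cone_def)
    finally show "x $ i = P i j * x $ j" using x by (auto simp: cone_def intro: antisym)
  qed
qed

lemma subspace_hull_space: "subspace hull_space"
  by (auto simp: subspace_def hull_space_def algebra_simps)

lemma column_max_ge_1: "1 \<le> (MAX i. P i j)"
proof -
  have "P j j \<le> (MAX i. P i j)" by (intro Max_ge) auto
  then show ?thesis by (simp only: refl)
qed

lemma column_eq_scaled: "column j = (MAX i. P i j) *\<^sub>R scaled_column j"
  using column_max_ge_1[of j] by (simp add: scaled_column_def)

lemma scaled_column_max: "(MAX i. scaled_column j $ i) = 1"
  using column_max_ge_1[of j] MAX_cmult[of "1 / (MAX i. P i j)" "\<lambda>i. P i j"]
  by (simp add: scaled_column_def)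

lemma scaled_column_in_cone: "scaled_column j \<in> cone"
  using column_max_ge_1[of j] by (simp add: scaled_column_def scale_in_cone column_in_cone)

text \<open>Taking maxima in \<open>c *\<^sub>R u = column j\<close> identifies \<open>c\<close> as
  the factor that scaling divides out.\<close>

lemma scaled_column_eqI:
  assumes "(MAX i. u $ i) = 1" and "c *\<^sub>R u = column j" and "0 \<le> c"
  shows "u = scaled_column j"
proof -
  have "(MAX i. P i j) = (MAX i. c * u $ i)"
    using assms(2) by (metis column_nth real_scaleR_def vector_scaleR_component)
  then have "(MAX i. P i j) = c"
    using MAX_cmult[OF assms(3), of "\<lambda>i. u $ i"] assms(1) by simp
  then show ?thesis
    using assms(2) column_max_ge_1[of j] by (auto simp: scaled_column_def simp flip: assms(2))
qed

text \<open>Forwards, the diagonal entries are 1, so coordinates \<open>i\<close> and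
  \<open>j\<close> of the equal vectors give \<open>P i j\<close> and \<open>P j i\<close> as
  reciprocal ratios of the column maxima. Backwards, a loop of product 1 turns the triangle
  inequality through \<open>i\<close> into an equality, so the columns are proportional.\<close>

lemma scaled_column_eq_iff: "scaled_column i = scaled_column j \<longleftrightarrow> equi i j"
proof
  assume *: "scaled_column i = scaled_column j"
  define a b where "a = (MAX k. P k i)" and "b = (MAX k. P k j)"
  have ab: "a \<ge> 1" "b \<ge> 1" using column_max_ge_1 by (auto simp: a_def b_def)
  have "P k i / a = P k j / b" for k
    using arg_cong[OF *, of "\<lambda>x. x $ k"] by (simp add: scaled_column_def a_def b_def)
  from this[of i] this[of j] have "P i j = b / a" "P j i = a / b"
    using ab by (auto simp: refl field_simps)
  then show "equi i j" using ab by (simp add: equi_def)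
next
  assume eq: "equi i j"
  have *: "P k j = P k i * P i j" for k
  proof (rule antisym)
    have "P k j = (P k j * P j i) * P i j"
      using eq by (simp add: equi_def mult.assoc mult.commute)
    also have "\<dots> \<le> P k i * P i j" by (intro mult_right_mono triangle nonneg)
    finally show "P k j \<le> P k i * P i j" .
  qed (rule triangle)
  have "column j = P i j *\<^sub>R column i"
    by (intro vec_eq_iff[THEN iffD2] allI) (subst column_nth, subst *, simp)
  then have "(P i j * (MAX k. P k i)) *\<^sub>R scaled_column i = column j"
    by (subst (asm) column_eq_scaled[of i]) simp
  then show "scaled_column i = scaled_column j"
    using column_max_ge_1[of i] nonneg[of i j]
    by (intro scaled_column_eqI[of _ "P i j * (MAX k. P k i)"] scaled_column_max) auto
qed

lemma equi_trans: "equi i j \<Longrightarrow> equi j k \<Longrightarrow> equi i k"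
  by (simp flip: scaled_column_eq_iff)

text \<open>The coordinate \<open>j\<close> singles out a summand that dominates, hence equals, the whole column.\<close>

lemma scaled_column_extremal:
  assumes "scaled_column j \<in> max_combinations S" and "S \<subseteq> cone"
    and "\<forall>u\<in>S. (MAX i. u $ i) = 1"
  shows "scaled_column j \<in> S"
proof -
  define s where "s = (MAX i. P i j)"
  have s: "s \<ge> 1" using column_max_ge_1 by (simp add: s_def)
  from assms(1) obtain T c where T: "finite T" "T \<subseteq> S" "\<forall>u\<in>T. 0 \<le> c u"
    and eq: "\<And>i. scaled_column j $ i = Max (insert 0 ((\<lambda>u. c u * u $ i) ` T))"
    by (rule max_combinationsE) blast
  have val: "scaled_column j $ i = P i j / s" for i by (simp add: scaled_column_def s_def)
  \<comment> \<open>The value at \<open>j\<close> is \<open>1 / s > 0\<close> because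
    \<open>P j j = 1\<close>, so it is attained by a summand and not by the inserted zero.\<close>
  have "Max (insert 0 ((\<lambda>u. c u * u $ j) ` T)) \<in> insert 0 ((\<lambda>u. c u * u $ j) ` T)"
    using T(1) by (intro Max_in) auto
  then have "1 / s \<in> insert 0 ((\<lambda>u. c u * u $ j) ` T)"
    using eq[of j] val[of j] refl by simp
  then obtain u where u: "u \<in> T" "c u * u $ j = 1 / s" using s by auto
  have cu: "u \<in> cone" "0 \<le> c u" using u T assms(2) by auto
  have "c u * u $ i = P i j / s" for i
  proof (rule antisym)
    show "c u * u $ i \<le> P i j / s"
      unfolding val[symmetric] eq using T(1) u(1) by (intro Max_ge) auto
    have "P i j / s = P i j * (c u * u $ j)" unfolding u(2) by simp
    also have "\<dots> = c u * (P i j * u $ j)" by simp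
    also have "\<dots> \<le> c u * u $ i" using cu by (intro mult_left_mono) (auto simp: cone_def)
    finally show "P i j / s \<le> c u * u $ i" .
  qed
  then have "(s * c u) *\<^sub>R u = column j" using s by (simp add: vec_eq_iff mult.assoc)
  then have "u = scaled_column j"
    using s cu assms(3) u T by (intro scaled_column_eqI) auto
  then show ?thesis using u T by auto
qed

text \<open>Each \<open>x\<close> in the cone is the maximum of the columns weighted by its own
  entries. Coefficients of a max combination belong to vectors, not to indices, so one index
  \<open>rep u\<close> is chosen for each distinct scaled column \<open>u\<close>.\<close>

lemma cone_subset_max_combinations: "cone \<subseteq> max_combinations (range scaled_column)"
proof
  fix x assume x: "x \<in> cone"
  define rep where "rep = inv_into UNIV scaled_column"
  \<comment> \<open>The second factor undoes the scaling, which leaves \<open>x $ rep u\<close>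
    times the unscaled column.\<close>
  define c where "c u = x $ rep u * (MAX i. P i (rep u))" for u
  have rep: "scaled_column (rep (scaled_column i)) = scaled_column i" for i
    unfolding rep_def by (rule f_inv_into_f) simp
  have c0: "0 \<le> c u" for u
    using x column_max_ge_1[of "rep u"] by (simp add: c_def cone_def)
  have cu: "c (scaled_column k) * scaled_column k $ i
      = P i (rep (scaled_column k)) * x $ rep (scaled_column k)" for i k
  proof -
    let ?r = "rep (scaled_column k)"
    have "c (scaled_column k) * scaled_column k $ i
        = x $ ?r * (((MAX i. P i ?r) *\<^sub>R scaled_column ?r) $ i)"
      unfolding c_def rep by simp
    then show ?thesis unfolding column_eq_scaled[symmetric] by simp
  qed
  have "x $ i = Max (insert 0 ((\<lambda>u. c u * u $ i) ` range scaled_column))" for i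
  proof (rule Max_eqI[symmetric])
    fix y assume "y \<in> insert 0 ((\<lambda>u. c u * u $ i) ` range scaled_column)"
    then show "y \<le> x $ i" using x by (auto simp: cu cone_def)
  next
    \<comment> \<open>The maximum in row \<open>i\<close> is attained at the representative of the
      class of \<open>i\<close>, by the class equations.\<close>
    let ?r = "rep (scaled_column i)"
    have "equi i ?r" using rep[of i] by (simp flip: scaled_column_eq_iff)
    then have "x $ i = P i ?r * x $ ?r"
      using x cone_subset_hull_space by (auto simp: hull_space_def)
    then have "x $ i = c (scaled_column i) * scaled_column i $ i"
      by (simp add: cu)
    then show "x $ i \<in> insert 0 ((\<lambda>u. c u * u $ i) ` range scaled_column)" by blast
  qed simp
  then show "x \<in> max_combinations (range scaled_column)"
    unfolding max_combinations_def using c0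
    by (intro CollectI exI[of _ "range scaled_column"] exI[of _ c]) (auto simp: vec_eq_iff)
qed

text \<open>Extremality puts every scaled column into any scaled basis; these columns already
  generate the cone, so a further element would be a combination of the others. Uniqueness gives the
  \<open>THE\<close> in \<open>max_dim\<close> its value.\<close>

lemma scaled_max_basis_cone_iff: "scaled_max_basis cone S \<longleftrightarrow> S = range scaled_column"
proof
  have "scaled_column i \<notin> max_combinations (range scaled_column - {scaled_column i})" for i
    using scaled_column_extremal[of i "range scaled_column - {scaled_column i}"]
      scaled_column_in_cone scaled_column_max by blast
  then show "S = range scaled_column \<Longrightarrow> scaled_max_basis cone S"
    using scaled_column_in_cone scaled_column_max cone_subset_max_combinations
    unfolding scaled_max_basis_def max_basis_def by auto
next
  assume S: "scaled_max_basis cone S"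
  then have sub: "range scaled_column \<subseteq> S"
    using scaled_column_extremal[of _ S] scaled_column_in_cone
    unfolding scaled_max_basis_def max_basis_def by blast
  have "u \<in> range scaled_column" if "u \<in> S" for u
  proof (rule ccontr)
    assume "u \<notin> range scaled_column"
    then have "max_combinations (range scaled_column) \<subseteq> max_combinations (S - {u})"
      using sub by (intro max_combinations_mono) blast
    then show False
      using S that cone_subset_max_combinations
      unfolding scaled_max_basis_def max_basis_def by blast
  qed
  with sub show "S = range scaled_column" by blast
qed

lemma max_dim_cone: "max_dim cone = card (range scaled_column)"
  by (simp add: max_dim_def scaled_max_basis_cone_iff)

section \<open>Linear dimension of the hull space\<close>

text \<open>Cutting a column down to its class may leave the cone but stays in
  \<open>hull_space\<close>, since the class equations never link different classes.\<close>

definition class_column :: "'n \<Rightarrow> real ^ 'n" where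
  "class_column j = (\<chi> i. if equi i j then P i j else 0)"

lemma class_column_nth: "class_column j $ i = (if equi i j then P i j else 0)"
  by (simp add: class_column_def)

lemma class_column_in_hull_space: "class_column j \<in> hull_space"
proof -
  have "class_column j $ i = P i k * class_column j $ k" if ik: "equi i k" for i k
  proof -
    have "equi i j \<longleftrightarrow> equi k j" using ik equi_sym equi_trans by blast
    moreover have "column j $ i = P i k * column j $ k"
      using cone_subset_hull_space column_in_cone[of j] ik unfolding hull_space_def by blast
    ultimately show ?thesis by (simp add: class_column_nth)
  qed
  then show ?thesis unfolding hull_space_def by blast
qed

text \<open>Columns restricted to their equivalence classes have disjoint supports.\<close>

lemma dim_hull_space: "dim hull_space = card (range scaled_column)"
proof -
  \<comment> \<open>\<open>R\<close> contains exactly one index of each class.\<close>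
  obtain R where inj: "inj_on scaled_column R" and R: "range scaled_column = scaled_column ` R"
    using subset_image_inj[of "range scaled_column" scaled_column UNIV] by auto
  have ex: "\<exists>j\<in>R. equi i j" for i
  proof -
    have "scaled_column i \<in> scaled_column ` R" using R by blast
    then show ?thesis by (auto simp: scaled_column_eq_iff)
  qed
  have uniq: "j = k" if "j \<in> R" "k \<in> R" "equi i j" "equi i k" for i j k
    using that inj by (metis inj_onD scaled_column_eq_iff)
  have self: "equi j j" for j by (simp add: equi_def refl)
  have inj': "inj_on class_column R"
  proof (rule inj_onI)
    fix j k assume "j \<in> R" "k \<in> R" "class_column j = class_column k"
    then have "class_column k $ j = 1" by (metis class_column_nth refl self)
    then have "equi j k" by (auto simp: class_column_nth split: if_splits)
    then show "j = k" using uniq self \<open>j \<in> R\<close> \<open>k \<in> R\<close> by blast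
  qed
  have "class_column j \<noteq> 0" for j
    by (metis class_column_nth refl self zero_index zero_neq_one)
  moreover have "pairwise orthogonal (class_column ` R)"
  proof (unfold pairwise_def, safe)
    fix j k assume jk: "j \<in> R" "k \<in> R" "class_column j \<noteq> class_column k"
    then have "class_column j $ i * class_column k $ i = 0" for i
      using uniq[of j k i] by (auto simp: class_column_nth)
    then show "orthogonal (class_column j) (class_column k)"
      unfolding orthogonal_def inner_vec_def inner_real_def by (intro sum.neutral) blast
  qed
  ultimately have "independent (class_column ` R)"
    by (intro pairwise_orthogonal_independent) auto
  moreover have "hull_space \<subseteq> span (class_column ` R)"
  proof
    fix x assume x: "x \<in> hull_space"
    \<comment> \<open>Only the representative \<open>k\<close> of the class of \<open>i\<close>
      contributes, and its class equation returns \<open>x $ i\<close>.\<close>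
    have "(\<Sum>j\<in>R. x $ j * class_column j $ i) = x $ i" for i
    proof -
      obtain k where k: "k \<in> R" "equi i k" using ex by blast
      have "(\<Sum>j\<in>R. x $ j * class_column j $ i)
          = (\<Sum>j\<in>R. if j = k then x $ k * class_column k $ i else 0)"
      proof (intro sum.cong HOL.refl)
        fix j assume "j \<in> R"
        then have "\<not> equi i j" if "j \<noteq> k" using uniq k that by blast
        then show "x $ j * class_column j $ i = (if j = k then x $ k * class_column k $ i else 0)"
          by (auto simp: class_column_nth)
      qed
      also have "\<dots> = x $ k * P i k" using k by (simp add: class_column_nth)
      also have "\<dots> = x $ i" using x k by (auto simp: hull_space_def)
      finally show ?thesis .
    qed
    then have "x = (\<Sum>j\<in>R. x $ j *\<^sub>R class_column j)" by (simp add: vec_eq_iff)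
    also have "\<dots> \<in> span (class_column ` R)" by (intro span_sum span_scale span_base) auto
    finally show "x \<in> span (class_column ` R)" .
  qed
  ultimately have "dim hull_space = card (class_column ` R)"
    using class_column_in_hull_space by (intro basis_card_eq_dim[symmetric] dim_unique) auto
  then show ?thesis using R inj inj' by (simp add: card_image)
qed

end

section \<open>Weights of walks and the maximum cycle mean\<close>

text \<open>The weight multiplies over consecutive pairs only, so a cycle \<open>p\<close> has to be
  traversed as \<open>p @ [hd p]\<close>. A single node carries the empty product 1.\<close>

fun walk_weight :: "('n \<Rightarrow> 'n \<Rightarrow> real) \<Rightarrow> 'n list \<Rightarrow> real" where
  "walk_weight B (x # y # ys) = B x y * walk_weight B (y # ys)"
| "walk_weight B _ = 1"

lemma walk_weight_append:
  "walk_weight B (xs @ y # ys) = walk_weight B (xs @ [y]) * walk_weight B (y # ys)"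
proof (induction xs)
  case (Cons x xs)
  then show ?case by (cases xs) auto
qed simp

lemma walk_weight_nonneg: "(\<And>i j. 0 \<le> B i j) \<Longrightarrow> 0 \<le> walk_weight B p"
  by (induction B p rule: walk_weight.induct) auto

lemma walk_weight_divide:
  "walk_weight (\<lambda>i j. B i j / c) (x # xs) = walk_weight B (x # xs) / c ^ length xs"
  by (induction xs arbitrary: x) auto

lemma walk_weight_prod: "walk_weight B (x # xs) = (\<Prod>k<length xs. B ((x # xs) ! k) (xs ! k))"
proof (induction xs arbitrary: x)
  case (Cons y ys)
  show ?case
    unfolding walk_weight.simps Cons.IH by (simp add: prod.lessThan_Suc_shift del: prod.lessThan_Suc)
qed simp

text \<open>Translates the modular successor of the cycle definitions into the plain successor along
  a closed walk.\<close>

lemma closed_walk_nth: "k < length p \<Longrightarrow> p ! (Suc k mod length p) = (p @ [hd p]) ! Suc k"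
  by (cases p; cases "Suc k = length p") (auto simp: nth_append)

lemma cycle_edges_iff:
  "(i, j) \<in> cycle_edges p \<longleftrightarrow> (\<exists>k<length p. i = (p @ [hd p]) ! k \<and> j = (p @ [hd p]) ! Suc k)"
  by (auto simp: cycle_edges_def closed_walk_nth nth_append_left)

lemma cycle_mean_walk:
  assumes "p \<noteq> []"
  shows "cycle_mean A p = root (length p) (walk_weight (\<lambda>i j. A $ i $ j) (p @ [hd p]))"
proof -
  obtain x xs where p: "p = x # xs" using assms by (cases p) auto
  have "(\<Prod>k<length p. A $ (p ! k) $ (p ! (Suc k mod length p)))
      = (\<Prod>k<length (xs @ [x]). A $ ((x # xs @ [x]) ! k) $ ((xs @ [x]) ! k))"
    using closed_walk_nth[of _ p] nth_append_left[of _ "x # xs" "[x]"]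
    by (intro prod.cong) (auto simp: p)
  then show ?thesis by (simp add: cycle_mean_def p walk_weight_prod)
qed

lemma finite_distinct_lists: "finite {p :: 'n::finite list. distinct p \<and> Q p}"
  by (rule finite_subset[OF _ finite_subset_distinct[OF finite[of "UNIV :: 'n set"]]]) auto

text \<open>A repeated node splits a closed walk into two shorter closed walks.\<close>

lemma closed_walk_weight_le:
  assumes "\<And>i j. 0 \<le> B i j" and "0 \<le> m"
    and "\<And>q. q \<noteq> [] \<Longrightarrow> distinct q \<Longrightarrow> walk_weight B (q @ [hd q]) \<le> m ^ length q"
    and "p \<noteq> []"
  shows "walk_weight B (p @ [hd p]) \<le> m ^ length p"
  using \<open>p \<noteq> []\<close>
proof (induction "length p" arbitrary: p rule: less_induct)
  case less
  show ?case
  proof (cases "distinct p")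
    case False
    then obtain xs ys zs y where p: "p = xs @ [y] @ ys @ [y] @ zs"
      using not_distinct_decomp by blast
    define q where "q = xs @ y # zs"
    have hd: "hd p = hd q" by (cases xs) (auto simp: p q_def)
    have split: "walk_weight B (xs @ y # us)
        = walk_weight B (xs @ [y]) * walk_weight B (y # us)" for us
      by (rule walk_weight_append)
    have "walk_weight B (p @ [z]) = walk_weight B (q @ [z]) * walk_weight B (y # ys @ [y])" for z
      using walk_weight_append[of B "y # ys" y "zs @ [z]"] split[of "zs @ [z]"]
        split[of "ys @ y # zs @ [z]"]
      by (simp add: p q_def)
    then have "walk_weight B (p @ [hd p]) = walk_weight B (q @ [hd q]) * walk_weight B (y # ys @ [y])"
      by (simp only: hd)
    also have "\<dots> \<le> m ^ length q * m ^ length (y # ys)"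
      using less.hyps[of q] less.hyps[of "y # ys"] walk_weight_nonneg[OF assms(1)] assms(2)
      by (intro mult_mono) (auto simp: p q_def)
    also have "\<dots> = m ^ length p" by (simp add: p q_def ac_simps flip: power_add)
    finally show ?thesis .
  qed (use assms less in blast)
qed

text \<open>Cycles may repeat nodes, so \<open>GREATEST\<close> ranges over infinitely many lists.
  The maximum \<open>m\<close> over the finitely many simple cycles exists and, by
  \<open>closed_walk_weight_le\<close>, bounds all the others.\<close>

lemma cycle_mean_le_max_cycle_mean:
  fixes A :: "real ^ 'n ^ 'n"
  assumes "nonneg_matrix A" and "p \<noteq> []"
  shows "cycle_mean A p \<le> max_cycle_mean A"
proof -
  let ?B = "\<lambda>i j. A $ i $ j"
  let ?D = "{p :: 'n list. distinct p \<and> p \<noteq> []}"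
  have B: "0 \<le> ?B i j" for i j using assms(1) by (simp add: nonneg_matrix_def)
  define m where "m = Max (cycle_mean A ` ?D)"
  have fin: "finite (cycle_mean A ` ?D)" by (intro finite_imageI finite_distinct_lists)
  have ne: "[undefined] \<in> ?D" by simp
  have le: "cycle_mean A q \<le> m" if "q \<in> ?D" for q
    unfolding m_def using fin that by (intro Max_ge) auto
  have pos: "0 \<le> cycle_mean A q" if "q \<noteq> []" for q
    using walk_weight_nonneg[of ?B, OF B] that by (simp add: cycle_mean_walk)
  have m0: "0 \<le> m" using le[OF ne] pos[of "[undefined]"] by simp
  have dist: "walk_weight ?B (q @ [hd q]) \<le> m ^ length q" if "q \<noteq> []" "distinct q" for q
  proof -
    have "walk_weight ?B (q @ [hd q]) = cycle_mean A q ^ length q"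
      using that walk_weight_nonneg[of ?B, OF B] by (simp add: cycle_mean_walk)
    also have "\<dots> \<le> m ^ length q" using le[of q] pos[of q] that by (intro power_mono) auto
    finally show ?thesis .
  qed
  have all: "cycle_mean A q \<le> m" if "q \<noteq> []" for q
  proof -
    have "cycle_mean A q \<le> root (length q) (m ^ length q)"
      using closed_walk_weight_le[of ?B m q, OF B m0 dist that] that
      by (simp add: cycle_mean_walk)
    also have "\<dots> = m" using m0 that by (simp add: real_root_power_cancel)
    finally show ?thesis .
  qed
  have "m \<in> cycle_mean A ` ?D" unfolding m_def using fin ne by (intro Max_in) auto
  then have "\<exists>p. p \<noteq> [] \<and> m = cycle_mean A p" by blast
  then have "max_cycle_mean A = m"
    unfolding max_cycle_mean_def using all by (intro Greatest_equality) blast+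
  then show ?thesis using all assms(2) by simp
qed

text \<open>Deleting closed subwalks shows that, as soon as no closed walk has weight above 1, restricting the maximum to simple walks is no restriction.\<close>

definition star :: "('n::finite \<Rightarrow> 'n \<Rightarrow> real) \<Rightarrow> 'n \<Rightarrow> 'n \<Rightarrow> real" where
  "star B i j =
    Max (insert 0 (walk_weight B ` {p. distinct p \<and> p \<noteq> [] \<and> hd p = i \<and> last p = j}))"

section \<open>The star of weights without closed walks above 1\<close>

locale subcritical_weights =
  fixes B :: "'n::finite \<Rightarrow> 'n \<Rightarrow> real"
  assumes B_nonneg: "0 \<le> B i j"
    and closed_walk_le_1: "walk_weight B (x # xs @ [x]) \<le> 1"
begin

lemma walk_weight_le_star: "p \<noteq> [] \<Longrightarrow> walk_weight B p \<le> star B (hd p) (last p)"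
proof (induction "length p" arbitrary: p rule: less_induct)
  case less
  show ?case
  proof (cases "distinct p")
    case True
    then show ?thesis
      unfolding star_def using less.prems
      by (intro Max_ge finite.insertI finite_imageI finite_distinct_lists) auto
  next
    case False
    then obtain xs ys zs y where p: "p = xs @ [y] @ ys @ [y] @ zs"
      using not_distinct_decomp by blast
    define q where "q = xs @ y # zs"
    have hd: "hd p = hd q" by (cases xs) (auto simp: p q_def)
    have last: "last p = last q" by (auto simp: p q_def)
    have "walk_weight B p = walk_weight B q * walk_weight B (y # ys @ [y])"
      using walk_weight_append[of B xs y zs] walk_weight_append[of B xs y "ys @ y # zs"]
        walk_weight_append[of B "y # ys" y zs]
      by (simp add: p q_def)
    also have "\<dots> \<le> walk_weight B q"
      using closed_walk_le_1 walk_weight_nonneg[of B q] B_nonneg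
      by (intro mult_left_le) auto
    also have "\<dots> \<le> star B (hd q) (last q)" using less.hyps[of q] by (simp add: p q_def)
    finally show ?thesis by (simp add: hd last)
  qed
qed

lemma star_nonneg: "0 \<le> star B i j"
  unfolding star_def by (intro Max_ge) (auto intro: finite_distinct_lists)

text \<open>A nonzero value cannot come from the zero inserted in \<open>star\<close>, so it belongs
  to an actual walk.\<close>

lemma star_attained:
  assumes "star B i j \<noteq> 0"
  obtains p where "p \<noteq> []" "hd p = i" "last p = j" "walk_weight B p = star B i j"
proof -
  let ?W = "walk_weight B ` {p. distinct p \<and> p \<noteq> [] \<and> hd p = i \<and> last p = j}"
  have "Max (insert 0 ?W) \<in> insert 0 ?W"
    by (intro Max_in) (auto intro: finite_distinct_lists)
  then have "star B i j \<in> ?W" using assms by (simp add: star_def)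
  then show ?thesis using that by auto
qed

lemma edge_le_star: "B i j \<le> star B i j"
  using walk_weight_le_star[of "[i, j]"] by simp

text \<open>Two optimal walks are joined at \<open>j\<close>, which is kept only once.\<close>

lemma star_triangle: "star B i j * star B j k \<le> star B i k"
proof (cases "star B i j = 0 \<or> star B j k = 0")
  case True
  then show ?thesis using star_nonneg by auto
next
  case False
  then obtain p q where p: "p \<noteq> []" "hd p = i" "last p = j" "walk_weight B p = star B i j"
    and q: "q \<noteq> []" "hd q = j" "last q = k" "walk_weight B q = star B j k"
    using star_attained by metis
  obtain xs where xs: "p = xs @ [j]" using p by (metis append_butlast_last_id)
  obtain ys where ys: "q = j # ys" using q by (metis list.collapse)
  have "hd (xs @ j # ys) = i" using p xs by (cases xs) auto
  then show ?thesis
    using walk_weight_le_star[of "xs @ j # ys"] walk_weight_append[of B xs j ys] p q xs ys by auto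
qed

text \<open>The one-node walk has weight 1; any other walk from \<open>i\<close> to \<open>i\<close>
  is closed and weighs at most 1.\<close>

lemma star_refl: "star B i i = 1"
proof (rule antisym)
  show "1 \<le> star B i i" using walk_weight_le_star[of "[i]"] by simp
  show "star B i i \<le> 1"
  proof (cases "star B i i = 0")
    case False
    then obtain p where p: "p \<noteq> []" "hd p = i" "last p = i" "walk_weight B p = star B i i"
      by (rule star_attained)
    show ?thesis
    proof (cases "tl p = []")
      case True
      then have "p = [i]" using p by (metis list.collapse)
      then show ?thesis using p by simp
    next
      case False
      then have "p = i # butlast (tl p) @ [i]"
        using p by (metis append_butlast_last_id last_tl list.collapse)
      then show ?thesis using p closed_walk_le_1[of i "butlast (tl p)"] by simp
    qed
  qed simp
qed

sublocale kleene_star "star B"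
  by standard (rule star_nonneg star_refl star_triangle)+

lemma walk_weight_subeigen:
  assumes "\<And>i j. B i j * x $ j \<le> x $ i" and "p \<noteq> []"
  shows "walk_weight B p * x $ last p \<le> x $ hd p"
  using assms(2)
proof (induction p rule: induct_list012)
  case (3 i j p)
  have "walk_weight B (i # j # p) * x $ last (i # j # p)
      = B i j * (walk_weight B (j # p) * x $ last (j # p))" by simp
  also have "\<dots> \<le> B i j * x $ j" using 3 B_nonneg by (intro mult_left_mono) auto
  also have "\<dots> \<le> x $ i" by (rule assms)
  finally show ?case by simp
qed auto

text \<open>One inclusion uses that the star dominates \<open>B\<close>; the other chains the
  inequalities for \<open>B\<close> along an optimal walk.\<close>

lemma cone_eq: "cone = {x. (\<forall>i. 0 \<le> x $ i) \<and> (\<forall>i j. B i j * x $ j \<le> x $ i)}"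
proof (intro set_eqI iffI)
  fix x assume "x \<in> cone"
  moreover have "B i j * x $ j \<le> star B i j * x $ j" if "0 \<le> x $ j" for i j
    using that edge_le_star by (rule mult_right_mono[rotated])
  ultimately show "x \<in> {x. (\<forall>i. 0 \<le> x $ i) \<and> (\<forall>i j. B i j * x $ j \<le> x $ i)}"
    unfolding cone_def by (blast intro: order_trans)
next
  fix x assume x: "x \<in> {x. (\<forall>i. 0 \<le> x $ i) \<and> (\<forall>i j. B i j * x $ j \<le> x $ i)}"
  have "star B i j * x $ j \<le> x $ i" for i j
  proof (cases "star B i j = 0")
    case False
    then obtain p where "p \<noteq> []" "hd p = i" "last p = j" "walk_weight B p = star B i j"
      by (rule star_attained)
    then show ?thesis using walk_weight_subeigen[of x p] x by auto
  qed (use x in simp)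
  with x show "x \<in> cone" by (simp add: cone_def)
qed

section \<open>Critical edges and the linear hull\<close>

text \<open>The edge, completed by an optimal walk back, closes up with weight 1.\<close>

definition tight :: "'n \<Rightarrow> 'n \<Rightarrow> bool" where
  "tight i j \<longleftrightarrow> B i j * star B j i = 1"

text \<open>Replacing \<open>B i j\<close> by the star can only raise the product, yet it stays at
  most 1; cancelling \<open>star B j i\<close> gives the second claim.\<close>

lemma tight_imp_equi:
  assumes "tight i j"
  shows "equi i j" and "star B i j = B i j"
proof -
  have 1: "B i j * star B j i = 1" using assms by (simp add: tight_def)
  have "B i j * star B j i \<le> star B i j * star B j i"
    by (intro mult_right_mono edge_le_star star_nonneg)
  then have 2: "star B i j * star B j i = 1" using loop_le_1[of i j] 1 by linarith
  then show "equi i j" by (simp add: equi_def)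
  show "star B i j = B i j" using 1 2 by (metis mult_right_cancel mult_zero_right zero_neq_one)
qed

text \<open>The sum of the columns of the star satisfies all inequalities outside the critical edges
  strictly, so it can be perturbed in every direction that respects the critical equations.\<close>

lemma tight_space_subset_span:
  assumes y: "\<And>i j. tight i j \<Longrightarrow> B i j * y $ j = y $ i"
  shows "y \<in> span cone"
proof -
  define x where "x = (\<Sum>k\<in>UNIV. column k)"
  have xi: "x $ i = (\<Sum>k\<in>UNIV. star B i k)" for i by (simp add: x_def)
  have x_pos: "0 < x $ i" for i
    unfolding xi using star_nonneg star_refl[of i]
    by (intro sum_pos2[of UNIV i]) auto
  have Bs: "B i j * star B j k \<le> star B i k" for i j k
    using column_in_cone[of k] by (auto simp: cone_eq)
  have x_sub: "B i j * x $ j \<le> x $ i" for i j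
    unfolding xi sum_distrib_left by (intro sum_mono Bs)
  have strict: "B i j * x $ j < x $ i" if "\<not> tight i j" for i j
  proof -
    \<comment> \<open>The summand \<open>k = i\<close> is the strict one: equality there would make
      the edge tight.\<close>
    have "B i j * star B j i < star B i i"
      using Bs[of i j i] that star_refl[of i] by (auto simp: tight_def less_le)
    then show ?thesis unfolding xi sum_distrib_left using Bs
      by (intro sum_strict_mono_ex1) auto
  qed
  have cont: "((\<lambda>e. x $ i + e * y $ i) \<longlongrightarrow> x $ i) (at_right 0)" for i
    by (rule tendsto_eq_intros | simp)+
  have "\<forall>\<^sub>F e in at_right 0. \<forall>i. 0 < x $ i + e * y $ i"
    by (intro eventually_all_finite order_tendstoD[OF cont] x_pos)
  moreover have "\<forall>\<^sub>F e in at_right 0. \<forall>i j. B i j * (x $ j + e * y $ j) \<le> x $ i + e * y $ i"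
  proof (intro eventually_all_finite)
    fix i j
    show "\<forall>\<^sub>F e in at_right 0. B i j * (x $ j + e * y $ j) \<le> x $ i + e * y $ i"
    proof (cases "tight i j")
      case True
      \<comment> \<open>On a tight edge the perturbation adds the same amount to both sides.\<close>
      have "B i j * (x $ j + e * y $ j) \<le> x $ i + e * y $ i" for e
        using y[OF True] x_sub[of i j] by (simp add: distrib_left mult.left_commute)
      then show ?thesis by simp
    next
      case False
      have "((\<lambda>e. x $ i + e * y $ i - B i j * (x $ j + e * y $ j)) \<longlongrightarrow> x $ i - B i j * x $ j)
          (at_right 0)"
        by (intro tendsto_diff tendsto_mult tendsto_const cont)
      then have "\<forall>\<^sub>F e in at_right 0. 0 < x $ i + e * y $ i - B i j * (x $ j + e * y $ j)"
        using strict[OF False] by (intro order_tendstoD(1)) auto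
      then show ?thesis by (rule eventually_mono) simp
    qed
  qed
  moreover have "\<forall>\<^sub>F e :: real in at_right 0. 0 < e" by (simp add: eventually_at_right_less)
  ultimately have "\<forall>\<^sub>F e in at_right 0. 0 < e \<and> x + e *\<^sub>R y \<in> cone"
    by eventually_elim (auto simp: cone_eq less_imp_le)
  then obtain e where e: "0 < e" "x + e *\<^sub>R y \<in> cone"
    using eventually_happens'[OF trivial_limit_at_right_real] by blast
  have "x \<in> cone" using x_pos x_sub by (auto simp: cone_eq less_imp_le)
  \<comment> \<open>\<open>y\<close> is a multiple of a difference of two cone points.\<close>
  then have "(1 / e) *\<^sub>R ((x + e *\<^sub>R y) - x) \<in> span cone"
    using e by (intro span_scale span_diff span_base)
  then show ?thesis using e by simp
qed

text \<open>A cycle of three inclusions yields both equalities, with no need to propagate the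
  critical equations along walks.\<close>

lemma hull_space_eq_tight: "hull_space = {x. \<forall>i j. tight i j \<longrightarrow> B i j * x $ j = x $ i}"
  and hull_space_eq_span: "hull_space = span cone"
proof -
  let ?T = "{x. \<forall>i j. tight i j \<longrightarrow> B i j * x $ j = x $ i}"
  have "hull_space \<subseteq> ?T"
    unfolding hull_space_def using tight_imp_equi by (intro Collect_mono allI impI) metis
  moreover have "?T \<subseteq> span cone" using tight_space_subset_span by blast
  moreover have "span cone \<subseteq> hull_space"
    by (intro span_minimal cone_subset_hull_space subspace_hull_space)
  ultimately show "hull_space = ?T" "hull_space = span cone" by auto
qed

text \<open>An optimal return walk closes a tight edge to a cycle of weight 1. Conversely, such a
  cycle is cut at the edge, and what remains is a walk from \<open>j\<close> to
  \<open>i\<close>.\<close>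

lemma tight_iff_critical:
  "tight i j \<longleftrightarrow> (\<exists>p. p \<noteq> [] \<and> walk_weight B (p @ [hd p]) = 1 \<and> (i, j) \<in> cycle_edges p)"
proof
  assume t: "tight i j"
  then have "star B j i \<noteq> 0" by (auto simp: tight_def)
  then obtain q where q: "q \<noteq> []" "hd q = j" "last q = i" "walk_weight B q = star B j i"
    by (rule star_attained)
  \<comment> \<open>\<open>butlast\<close> drops the final \<open>i\<close>, which closing the cycle
    restores.\<close>
  define p where "p = i # butlast q"
  have pq: "p @ [hd p] = i # q" using q by (metis append_Cons append_butlast_last_id list.sel(1) p_def)
  have "walk_weight B (i # q) = B i j * star B j i" using q by (cases q) auto
  moreover have "q ! 0 = j" using q by (simp add: hd_conv_nth)
  then have "(i, j) \<in> cycle_edges p" unfolding cycle_edges_iff pq by (auto simp: p_def intro!: exI[of _ 0])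
  ultimately show "\<exists>p. p \<noteq> [] \<and> walk_weight B (p @ [hd p]) = 1 \<and> (i, j) \<in> cycle_edges p"
    using t by (intro exI[of _ p]) (simp add: pq tight_def, simp add: p_def)
next
  assume "\<exists>p. p \<noteq> [] \<and> walk_weight B (p @ [hd p]) = 1 \<and> (i, j) \<in> cycle_edges p"
  then obtain p k where p: "p \<noteq> []" "walk_weight B (p @ [hd p]) = 1"
    and k: "k < length p" "i = (p @ [hd p]) ! k" "j = (p @ [hd p]) ! Suc k"
    by (auto simp: cycle_edges_iff)
  define q where "q = p @ [hd p]"
  define xs ys where "xs = take k q" and "ys = drop (Suc (Suc k)) q"
  have q: "q = xs @ i # j # ys"
    using k unfolding xs_def ys_def q_def[symmetric]
    by (metis Suc_less_eq Cons_nth_drop_Suc append_take_drop_id length_append_singleton less_SucI q_def)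
  have ends: "hd (xs @ [i]) = hd p" "last (j # ys) = hd p"
    using q p by (metis append_is_Nil_conv hd_append list.sel(1) q_def, 
                  metis last_ConsR last_append last_snoc list.distinct(1) q_def)
  have "1 = walk_weight B (xs @ [i]) * (B i j * walk_weight B (j # ys))"
    using p q walk_weight_append[of B xs i "j # ys"] by (simp add: q_def)
  also have "\<dots> = B i j * (walk_weight B (j # ys) * walk_weight B (xs @ [i]))" by simp
  \<comment> \<open>The two remaining pieces run from \<open>j\<close> to \<open>hd p\<close> and
    from \<open>hd p\<close> to \<open>i\<close>.\<close>
  also have "\<dots> \<le> B i j * (star B j (hd p) * star B (hd p) i)"
    using walk_weight_le_star[of "xs @ [i]"] walk_weight_le_star[of "j # ys"] ends
    by (intro mult_left_mono mult_mono B_nonneg star_nonneg walk_weight_nonneg) auto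
  also have "\<dots> \<le> B i j * star B j i" by (intro mult_left_mono star_triangle B_nonneg)
  finally have "1 \<le> B i j * star B j i" .
  moreover have "B i j * star B j i \<le> star B i j * star B j i"
    by (intro mult_right_mono edge_le_star star_nonneg)
  ultimately show "tight i j" using loop_le_1[of i j] unfolding tight_def by linarith
qed

end

section \<open>Normalisation by the maximum cycle mean and transfer to \<open>A\<close>\<close>

theorem theorem4p4:
  fixes A :: "real ^ 'n ^ 'n"
  assumes "nonneg_matrix A"
    and "max_cycle_mean A > 0"
  shows "max_dim (subeigencone A) = dim (critical_space A)
       \<and> critical_space A = span (subeigencone A)"
proof -
  define m where "m = max_cycle_mean A"
  have m: "0 < m" using assms(2) by (simp add: m_def)
  define B where "B i j = A $ i $ j / m" for i j
  have A0: "0 \<le> A $ i $ j" for i j using assms(1) by (simp add: nonneg_matrix_def)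
  have B0: "0 \<le> B i j" for i j using A0 m by (simp add: B_def)
  have mean: "cycle_mean A p = m * root (length p) (walk_weight B (p @ [hd p]))" if ne: "p \<noteq> []" for p
  proof -
    obtain x xs where p: "p = x # xs" using ne by (cases p) auto
    have "walk_weight B (x # xs @ [x]) = walk_weight (\<lambda>i j. A $ i $ j) (x # xs @ [x]) / m ^ length p"
      unfolding B_def walk_weight_divide by (simp add: p)
    then show ?thesis
      unfolding cycle_mean_walk[OF ne] using m
      by (simp add: p real_root_divide real_root_power_cancel del: power_Suc walk_weight.simps)
  qed
  \<comment> \<open>Cycle means of \<open>A\<close> are at most \<open>m\<close>, so after division
    by \<open>m\<close> no closed walk weighs more than 1.\<close>
  interpret subcritical_weights B
  proof
    fix x xs
    have "cycle_mean A (x # xs) \<le> m"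
      unfolding m_def by (intro cycle_mean_le_max_cycle_mean assms) simp
    then have "root (length (x # xs)) (walk_weight B (x # xs @ [x])) \<le> 1"
      using m by (simp add: mean del: walk_weight.simps)
    then show "walk_weight B (x # xs @ [x]) \<le> 1" by (subst (asm) real_root_le_1_iff) auto
  qed (rule B0)
  have sub: "subeigencone A = cone"
    unfolding subeigencone_def cone_eq max_mult_def m_def[symmetric]
    using m by (auto simp: B_def field_simps)
  have "critical_cycle A p \<longleftrightarrow> p \<noteq> [] \<and> walk_weight B (p @ [hd p]) = 1" for p
    unfolding critical_cycle_def m_def[symmetric] using m by (cases "p = []") (simp_all add: mean)
  then have "critical_edges A = {(i, j). tight i j}"
    unfolding critical_edges_def by (auto simp: tight_iff_critical)
  moreover have "A $ i $ j * x $ j = m * x $ i \<longleftrightarrow> B i j * x $ j = x $ i" for i j x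
    using m by (simp add: B_def divide_eq_eq mult.commute)
  ultimately have "critical_space A = hull_space"
    unfolding critical_space_def hull_space_eq_tight m_def[symmetric] by simp
  then show ?thesis
    using max_dim_cone dim_hull_space hull_space_eq_span sub by simp
qed

end
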